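(* Let $\mathcal{D}_Q=(Q_1,\dots,Q_n)$, $n\ge 1$, be a (query) decomposition of a query graph $Q$, and let $\mathcal{D}_G=(G_1,\dots,G_m)$, $m\ge 1$, be a (data graph) decomposition of a data graph $G$. Then, for a mapping $e$, the following statements are equivalent: (1) $e$ is a total embedding of $Q$ in $G$. (2) For every $j$ with $1\le j\le n$ there exist useful partial embeddings $e_{j,1},\dots,e_{j,k_j}$ of $Q_j$ in $G_{i_{j,1}},\dots,G_{i_{j,k_j}}$ respectively, for some indices $1\le i_{j,1}<\dots<i_{j,k_j}\le m$, such that: (a) for every $j$ with $1\le j\le n$ and every triple $(v,p,u)\in Q_j$ there exists some $\ell$ such that $e_{j,\ell}(v)$ and $e_{j,\ell}(u)$ are defined and $(e_{j,\ell}(v),p,e_{j,\ell}(u))\in G_{i_{j,\ell}}$; (b) for all $j_1,j_2,\ell_1,\ell_2$ with $1\le j_1\le j_2\le n$, $1\le \ell_1\le k_{j_1}$, $1\le \ell_2\le k_{j_2}$, the partial embeddings $e_{j_1,\ell_1}$ and $e_{j_2,\ell_2}$ are compatible; (c) the join of all the $e_{j,\ell_j}$, for $j\in\{1,\dots,n\}$ and $\ell_j\in\{1,\dots,k_j\}$, is $e$.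
   Context: Fix countably infinite, pairwise disjoint sets $U_{so}$ and $U_p$ (URIs), $L$ (literals) and $\mathrm{Var}$ (variables). A data graph is a non-empty set of triples in $U_{so}\times U_p\times(U_{so}\cup L)$. A query graph (query) is a non-empty set of triples in $(U_{so}\cup \mathrm{Var})\times U_p\times (U_{so}\cup L\cup \mathrm{Var})$. For a data or query graph $F$, $\mathcal{N}(F)$ (nodes) is the set of all subjects (first components) and objects (third components) of triples of $F$. A decomposition of a data (resp. query) graph $F$ is a tuple $(F_1,\dots,F_m)$, $m\ge1$, of data (resp. query) graphs (hence non-empty) with $F_i\subseteq F$ for all $i$ and $\bigcup_i F_i=F$ (overlaps are allowed). The $F_i$ are called segments. The border nodes of segment $F_i$ are $\mathcal{B}(F_i)=\bigcup_{j\ne i}\big((\mathcal{N}(F_i)\cap\mathcal{N}(F_j))\setminus L\big)$. A (total) embedding of a query $Q$ in a data graph $G$ is a total map $e:\mathcal{N}(Q)\to\mathcal{N}(G)$ with $e(v)=v$ for every non-variable $v\in\mathcal{N}(Q)$ and $(e(v_1),p,e(v_2))\in G$ for every $(v_1,p,v_2)\in Q$. A partial embedding of $Q$ in $G$ is a partial map $e:\mathcal{N}(Q)\to\mathcal{N}(G)$ such that for every $v\in\mathcal{N}(Q)$ with $e(v)$ defined: if $v$ is not a variable then $e(v)=v$; if $v$ is a variable then there exist a node $u\in\mathcal{N}(Q)$ with $e(u)$ defined and a predicate $p$ such that either $(v,p,u)\in Q$ and $(e(v),p,e(u))\in G$, or $(u,p,v)\in Q$ and $(e(u),p,e(v))\in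 G$. It is non-trivial if there is a triple $(v_1,p,v_2)\in Q$ with $e(v_1),e(v_2)$ defined and $(e(v_1),p,e(v_2))\in G$. Given a decomposition $(G_1,\dots,G_m)$ of $G$, a partial embedding $e$ of a query $Q$ in $G_i$ is useful if: (i) $e$ is non-trivial; (ii) $e$ is defined on all of $\mathcal{N}(Q)\cap\mathcal{N}(G_i)$; (iii) for each $(v,p,u)\in Q$, if $e(v)$ is defined and $e(v)\notin \mathcal{B}(G_i)\cup L$, then $e(u)$ is defined and $(e(v),p,e(u))\in G_i$; (iv) for each $(v,p,u)\in Q$, if $e(u)$ is defined and $e(u)\notin\mathcal{B}(G_i)\cup L$, then $e(v)$ is defined and $(e(v),p,e(u))\in G_i$. Two partial maps $e_1:D_1\to R_1$, $e_2:D_2\to R_2$ are compatible if $e_1(v)=e_2(v)$ for every $v\in D_1\cap D_2$ at which both are defined. The join of compatible $e_1,e_2$ is the partial map $D_1\cup D_2\to R_1\cup R_2$ equal to $e_1(v)$ where $e_1$ is defined, to $e_2(v)$ where only $e_2$ is defined, and undefined elsewhere; the join of finitely many mutually compatible partial maps is obtained by iterating (the operation is commutative and associative). Partial maps into $\mathcal{N}(G_i)$ are regarded as partial maps into $\mathcal{N}(G)$.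
   Formalization: In condition (iv) of "useful", the printed e(u) ∉ B(G_i) ∩ L is replaced by e(u) ∉ B(G_i) ∪ L, as in (iii); the printed intersection is always empty, and with it (1) ⇒ (2) fails when two triples of a query share an object mapped to a border node. *)

theory Defs
  imports "HOL-Library.Countable_Set"
begin

text \<open>All URIs, literals and variables live in one type \<open>'a\<close>; the four vocabularies are
  arbitrary sets in it and are passed as arguments to the notions that depend on them.\<close>

definition vocabulary :: "'a set \<Rightarrow> 'a set \<Rightarrow> 'a set \<Rightarrow> 'a set \<Rightarrow> bool" where
  "vocabulary Uso Up L Var \<longleftrightarrow>
     (countable Uso \<and> infinite Uso) \<and> (countable Up \<and> infinite Up) \<and>
     (countable L \<and> infinite L) \<and> (countable Var \<and> infinite Var) \<and>
     Uso \<inter> Up = {} \<and> Uso \<inter> L = {} \<and> Uso \<inter> Var = {} \<and>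
     Up \<inter> L = {} \<and> Up \<inter> Var = {} \<and> L \<inter> Var = {}"

type_synonym 'a graph = "('a \<times> 'a \<times> 'a) set"

definition data_graph :: "'a set \<Rightarrow> 'a set \<Rightarrow> 'a set \<Rightarrow> 'a graph \<Rightarrow> bool" where
  "data_graph Uso Up L G \<longleftrightarrow> G \<noteq> {} \<and> G \<subseteq> Uso \<times> Up \<times> (Uso \<union> L)"

definition query_graph :: "'a set \<Rightarrow> 'a set \<Rightarrow> 'a set \<Rightarrow> 'a set \<Rightarrow> 'a graph \<Rightarrow> bool" where
  "query_graph Uso Up L Var Q \<longleftrightarrow>
     Q \<noteq> {} \<and> Q \<subseteq> (Uso \<union> Var) \<times> Up \<times> (Uso \<union> L \<union> Var)"

definition nodes :: "'a graph \<Rightarrow> 'a set" where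
  "nodes F = {s. \<exists>p t. (s, p, t) \<in> F} \<union> {t. \<exists>s p. (s, p, t) \<in> F}"

text \<open>A tuple of segments is a list, indexed from 0. The argument \<open>is_graph\<close> is
  \<open>data_graph Uso Up L\<close> or \<open>query_graph Uso Up L Var\<close>.\<close>

definition decomposition :: "('a graph \<Rightarrow> bool) \<Rightarrow> 'a graph \<Rightarrow> 'a graph list \<Rightarrow> bool" where
  "decomposition is_graph F Fs \<longleftrightarrow>
     length Fs \<ge> 1 \<and>
     (\<forall>i < length Fs. is_graph (Fs ! i) \<and> Fs ! i \<subseteq> F) \<and>
     (\<Union>i < length Fs. Fs ! i) = F"

definition border :: "'a set \<Rightarrow> 'a graph list \<Rightarrow> nat \<Rightarrow> 'a set" where
  "border L Fs i =
     (\<Union>j \<in> {..<length Fs} - {i}. (nodes (Fs ! i) \<inter> nodes (Fs ! j)) - L)"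

text \<open>Partial maps are HOL maps; a partial map from \<open>D\<close> to \<open>R\<close> is a map \<open>e\<close> with
  \<open>dom e \<subseteq> D\<close> and \<open>ran e \<subseteq> R\<close>. The predicate \<open>sends e (v, p, u) H\<close> says that \<open>e v\<close> and
  \<open>e u\<close> are defined and that the image of the triple belongs to \<open>H\<close>.\<close>

fun sends :: "('a \<rightharpoonup> 'a) \<Rightarrow> 'a \<times> 'a \<times> 'a \<Rightarrow> 'a graph \<Rightarrow> bool" where
  "sends e (v, p, u) H \<longleftrightarrow> (\<exists>a b. e v = Some a \<and> e u = Some b \<and> (a, p, b) \<in> H)"

definition total_embedding :: "'a set \<Rightarrow> 'a graph \<Rightarrow> 'a graph \<Rightarrow> ('a \<rightharpoonup> 'a) \<Rightarrow> bool" where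
  "total_embedding Var Q G e \<longleftrightarrow>
     dom e = nodes Q \<and> ran e \<subseteq> nodes G \<and>
     (\<forall>v \<in> nodes Q. v \<notin> Var \<longrightarrow> e v = Some v) \<and>
     (\<forall>t \<in> Q. sends e t G)"

definition partial_embedding :: "'a set \<Rightarrow> 'a graph \<Rightarrow> 'a graph \<Rightarrow> ('a \<rightharpoonup> 'a) \<Rightarrow> bool" where
  "partial_embedding Var Q G e \<longleftrightarrow>
     dom e \<subseteq> nodes Q \<and> ran e \<subseteq> nodes G \<and>
     (\<forall>v \<in> dom e.
        (v \<notin> Var \<longrightarrow> e v = Some v) \<and>
        (v \<in> Var \<longrightarrow>
           (\<exists>u \<in> nodes Q \<inter> dom e. \<exists>p.
              ((v, p, u) \<in> Q \<and> sends e (v, p, u) G) \<or>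
              ((u, p, v) \<in> Q \<and> sends e (u, p, v) G))))"

definition nontrivial :: "'a graph \<Rightarrow> 'a graph \<Rightarrow> ('a \<rightharpoonup> 'a) \<Rightarrow> bool" where
  "nontrivial Q G e \<longleftrightarrow> (\<exists>t \<in> Q. sends e t G)"

text \<open>Usefulness of a partial embedding of \<open>Q\<close> in the segment \<open>Gs ! i\<close>. In the last clause the
  excluded set is the union \<open>border L Gs i \<union> L\<close>, as in the clause before it. The source prints an
  intersection there, which is empty since border nodes are never literals: the clause would then
  also constrain border nodes and literals, whose incoming triples may lie in other segments.\<close>

definition useful ::
  "'a set \<Rightarrow> 'a set \<Rightarrow> 'a graph list \<Rightarrow> nat \<Rightarrow> 'a graph \<Rightarrow> ('a \<rightharpoonup> 'a) \<Rightarrow> bool" where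
  "useful L Var Gs i Q e \<longleftrightarrow>
     partial_embedding Var Q (Gs ! i) e \<and>
     nontrivial Q (Gs ! i) e \<and>
     nodes Q \<inter> nodes (Gs ! i) \<subseteq> dom e \<and>
     (\<forall>v p u a. (v, p, u) \<in> Q \<and> e v = Some a \<and> a \<notin> border L Gs i \<union> L \<longrightarrow>
        sends e (v, p, u) (Gs ! i)) \<and>
     (\<forall>v p u b. (v, p, u) \<in> Q \<and> e u = Some b \<and> b \<notin> border L Gs i \<union> L \<longrightarrow>
        sends e (v, p, u) (Gs ! i))"

definition compatible :: "('a \<rightharpoonup> 'b) \<Rightarrow> ('a \<rightharpoonup> 'b) \<Rightarrow> bool" where
  "compatible e1 e2 \<longleftrightarrow> (\<forall>v \<in> dom e1 \<inter> dom e2. e1 v = e2 v)"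

text \<open>The first map takes precedence, whereas in \<open>(++)\<close> the second one does.\<close>

definition join :: "('a \<rightharpoonup> 'b) \<Rightarrow> ('a \<rightharpoonup> 'b) \<Rightarrow> ('a \<rightharpoonup> 'b)" where
  "join e1 e2 = e2 ++ e1"

definition join_list :: "('a \<rightharpoonup> 'b) list \<Rightarrow> ('a \<rightharpoonup> 'b)" where
  "join_list es = foldr join es Map.empty"

end

theory Submission
  imports Defs
begin

text \<open>Given a total embedding, one restricts it, for each pair of a query segment and a data
  segment, to the nodes incident to a query triple whose image lies in the data segment, together
  with the nodes the two segments share. If the image of a node under such a restriction is
  neither a border node nor a literal, then every data triple incident to it lies in that one data
  segment, whence usefulness. Conversely, compatibility makes the join extend each of the partial
  embeddings, so it sends every query triple to the data triple prescribed by the covering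
  condition.\<close>

section \<open>Nodes, segments and border nodes\<close>

lemma nodesI:
  assumes "(v, p, u) \<in> F"
  shows "v \<in> nodes F" "u \<in> nodes F"
  using assms by (auto simp: nodes_def)

lemma nodesE:
  assumes "x \<in> nodes F"
  obtains v p u where "(v, p, u) \<in> F" "x = v \<or> x = u"
  using assms by (auto simp: nodes_def)

lemma nodes_mono: "F \<subseteq> H \<Longrightarrow> nodes F \<subseteq> nodes H"
  by (auto simp: nodes_def)

lemma decomposition_subset:
  "decomposition P F Fs \<Longrightarrow> i < length Fs \<Longrightarrow> Fs ! i \<subseteq> F"
  by (simp add: decomposition_def)

lemma decomposition_is_graph:
  "decomposition P F Fs \<Longrightarrow> i < length Fs \<Longrightarrow> P (Fs ! i)"
  by (simp add: decomposition_def)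

lemma decomposition_cover:
  assumes "decomposition P F Fs" "t \<in> F"
  obtains i where "i < length Fs" "t \<in> Fs ! i"
  using assms by (auto simp: decomposition_def)

lemma decomposition_node_cover:
  assumes "decomposition P F Fs" "x \<in> nodes F"
  obtains i where "i < length Fs" "x \<in> nodes (Fs ! i)"
  using assms by (metis decomposition_cover nodesE nodesI)

lemma data_graph_node_not_Var:
  assumes "vocabulary Uso Up L Var" "data_graph Uso Up L G" "v \<in> nodes G"
  shows "v \<notin> Var"
  using assms unfolding vocabulary_def data_graph_def nodes_def by blast

text \<open>Used contrapositively: a non-literal node of a segment that is not a border node occurs
  in no other segment. This is what pins a data triple to one segment.\<close>

lemma borderI:
  assumes "a \<in> nodes (Gs ! i)" "a \<in> nodes (Gs ! i')" "i' < length Gs" "i' \<noteq> i" "a \<notin> L"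
  shows "a \<in> border L Gs i"
  using assms by (auto simp: border_def)

section \<open>Restrictions and joins of partial maps\<close>

lemma map_le_SomeD: "f \<subseteq>\<^sub>m g \<Longrightarrow> f v = Some a \<Longrightarrow> g v = Some a"
  by (metis domI map_le_def)

lemma sends_mono: "sends e t H \<Longrightarrow> e \<subseteq>\<^sub>m e' \<Longrightarrow> H \<subseteq> H' \<Longrightarrow> sends e' t H'"
  by (cases t) (auto dest: map_le_SomeD)

lemma compatible_sym: "compatible f g \<Longrightarrow> compatible g f"
  by (auto simp: compatible_def)

lemma compatible_restrict: "compatible (e |` A) (e |` B)"
  by (auto simp: compatible_def restrict_map_def)

lemma join_list_SomeD: "join_list es v = Some a \<Longrightarrow> \<exists>f \<in> set es. f v = Some a"
  by (induction es) (auto simp: join_list_def join_def map_add_Some_iff)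

lemma dom_join_list: "dom (join_list es) = (\<Union>f \<in> set es. dom f)"
  by (induction es) (auto simp: join_list_def join_def)

text \<open>Any value of the join is a value of some member, and that member agrees with
  \<open>f\<close> by compatibility, so the precedence built into \<open>join\<close> does not
  matter.\<close>

lemma map_le_join_list:
  assumes "f \<in> set es" "\<And>g. g \<in> set es \<Longrightarrow> compatible f g"
  shows "f \<subseteq>\<^sub>m join_list es"
  unfolding map_le_def
proof
  fix v assume v: "v \<in> dom f"
  then obtain a where a: "join_list es v = Some a"
    using assms(1) dom_join_list[of es] by blast
  then obtain g where "g \<in> set es" "g v = Some a"
    by (blast dest: join_list_SomeD)
  with v a show "f v = join_list es v"
    using assms(2)[of g] unfolding compatible_def by (metis IntI domI)
qed

text \<open>Members below a common map cannot disagree: each value of the join is a value of a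
  member, hence of \<open>e\<close>. The domain hypothesis then yields the reverse
  inclusion.\<close>

lemma join_list_eqI:
  assumes le: "\<And>f. f \<in> set es \<Longrightarrow> f \<subseteq>\<^sub>m e" and dom: "dom e \<subseteq> (\<Union>f \<in> set es. dom f)"
  shows "join_list es = e"
proof (rule map_le_antisym)
  show "join_list es \<subseteq>\<^sub>m e"
    unfolding map_le_def
  proof
    fix v assume "v \<in> dom (join_list es)"
    then obtain a where a: "join_list es v = Some a" by blast
    then obtain f where "f \<in> set es" "f v = Some a" by (blast dest: join_list_SomeD)
    with map_le_SomeD[OF le] a show "join_list es v = e v" by simp
  qed
  show "e \<subseteq>\<^sub>m join_list es"
    unfolding map_le_def
  proof
    fix v assume "v \<in> dom e"
    then obtain a where a: "join_list es v = Some a"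
      using dom dom_join_list[of es] by blast
    with join_list_SomeD obtain f where "f \<in> set es" "f v = Some a" by metis
    with map_le_SomeD[OF le] a show "e v = join_list es v" by simp
  qed
qed

section \<open>Restricting a total embedding to one data segment\<close>

text \<open>The first set keeps both ends of every triple sent into \<open>H\<close>; the second
  makes the restriction defined on all shared nodes, as usefulness demands. When \<open>H\<close> is
  a data graph, the second contributes only non-variables.\<close>

definition trace_dom :: "('a \<rightharpoonup> 'a) \<Rightarrow> 'a graph \<Rightarrow> 'a graph \<Rightarrow> 'a set" where
  "trace_dom e Q H = nodes {t \<in> Q. sends e t H} \<union> (nodes Q \<inter> nodes H)"

text \<open>Restriction loses no triple sent into \<open>H\<close>; this carries non-triviality, the
  edge clauses and the covering condition from \<open>e\<close> over to its restrictions.\<close>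

lemma sends_trace:
  assumes "t \<in> Q" "sends e t H"
  shows "sends (e |` trace_dom e Q H) t H"
proof (cases t)
  case (fields v p u)
  with assms have "v \<in> trace_dom e Q H" "u \<in> trace_dom e Q H"
    unfolding trace_dom_def by (auto intro: nodesI)
  with assms fields show ?thesis by simp
qed

text \<open>The properties are listed separately because \<open>e\<close> itself need not be a total
  embedding of \<open>Q'\<close>: its domain is \<open>nodes Q\<close>, which may be larger than
  \<open>nodes Q'\<close>.\<close>

lemma total_embedding_mono:
  assumes "total_embedding Var Q G e" "Q' \<subseteq> Q"
  shows "nodes Q' \<subseteq> dom e" "\<And>v. v \<in> nodes Q' \<Longrightarrow> v \<notin> Var \<Longrightarrow> e v = Some v"
    "\<And>t. t \<in> Q' \<Longrightarrow> sends e t G"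
  using assms nodes_mono[OF assms(2)] unfolding total_embedding_def by auto

text \<open>Shared nodes avoid \<open>Var\<close>, so \<open>e\<close> fixes them and their images
  stay in \<open>H\<close>. Every other node of the trace, in particular every variable, enters
  through a sent triple, which supplies the required neighbour.\<close>

lemma trace_partial_embedding:
  assumes fixes_nonvar: "\<And>v. v \<in> nodes Q \<Longrightarrow> v \<notin> Var \<Longrightarrow> e v = Some v"
    and H: "nodes H \<inter> Var = {}"
  shows "partial_embedding Var Q H (e |` trace_dom e Q H)"
proof -
  let ?f = "e |` trace_dom e Q H"
  have D: "trace_dom e Q H \<subseteq> nodes Q"
    unfolding trace_dom_def by (auto simp: nodes_def)
  have val: "a \<in> nodes H" if "?f v = Some a" for v a
  proof -
    from that have v: "v \<in> trace_dom e Q H" and ev: "e v = Some a"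
      by (auto simp: restrict_map_def split: if_splits)
    show ?thesis
    proof (cases "v \<in> nodes H")
      case True
      then show ?thesis using fixes_nonvar[of v] v D H ev by auto
    next
      case False
      then obtain x p y where "(x, p, y) \<in> Q" "sends e (x, p, y) H" "v = x \<or> v = y"
        using v unfolding trace_dom_def by (auto elim: nodesE)
      then show ?thesis using ev by (auto intro: nodesI)
    qed
  qed
  have ex: "\<exists>u \<in> nodes Q \<inter> dom ?f. \<exists>p.
      ((v, p, u) \<in> Q \<and> sends ?f (v, p, u) H) \<or> ((u, p, v) \<in> Q \<and> sends ?f (u, p, v) H)"
    if "v \<in> dom ?f" "v \<in> Var" for v
  proof -
    from that H have "v \<in> nodes {t \<in> Q. sends e t H}"
      by (auto simp: trace_dom_def)
    then obtain x p y where t: "(x, p, y) \<in> Q" "v = x \<or> v = y" and s: "sends e (x, p, y) H"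
      by (auto elim: nodesE)
    have sf: "sends ?f (x, p, y) H" using t(1) s by (rule sends_trace)
    then have "x \<in> dom ?f" "y \<in> dom ?f" unfolding sends.simps by (blast intro: domI)+
    with sf t nodesI[OF t(1)] show ?thesis by (metis IntI)
  qed
  have "dom ?f \<subseteq> nodes Q" using D by auto
  moreover have "ran ?f \<subseteq> nodes H" using val by (auto simp: ran_def)
  moreover have "?f v = Some v" if "v \<in> dom ?f" "v \<notin> Var" for v
    using that D fixes_nonvar[of v] by auto
  ultimately show ?thesis
    unfolding partial_embedding_def using ex by blast
qed

lemma trace_useful:
  assumes "vocabulary Uso Up L Var"
    and dec: "decomposition (data_graph Uso Up L) G Gs" and i: "i < length Gs"
    and tot: "total_embedding Var Q G e" and "Q' \<subseteq> Q"
    and nt: "nontrivial Q' (Gs ! i) e"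
  shows "useful L Var Gs i Q' (e |` trace_dom e Q' (Gs ! i))"
proof -
  let ?H = "Gs ! i" let ?f = "e |` trace_dom e Q' ?H"
  note te = total_embedding_mono[OF tot \<open>Q' \<subseteq> Q\<close>]
  have "nodes ?H \<inter> Var = {}"
    using data_graph_node_not_Var[OF assms(1) decomposition_is_graph[OF dec i]] by auto
  then have pe: "partial_embedding Var Q' ?H ?f"
    using te(2) by (intro trace_partial_embedding) auto
  have nt': "nontrivial Q' ?H ?f"
    using nt sends_trace unfolding nontrivial_def by blast
  have dom: "nodes Q' \<inter> nodes ?H \<subseteq> dom ?f"
    using te(1) by (auto simp: trace_dom_def)
  \<comment> \<open>Here \<open>w\<close> is either end of the triple, so both edge clauses of
    usefulness are handled at once.\<close>
  have edge: "sends ?f (v, p, u) ?H"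
    if t: "(v, p, u) \<in> Q'" and w: "w = v \<or> w = u" "?f w = Some a" "a \<notin> border L Gs i \<union> L"
    for v p u w a
  proof -
    obtain x y where xy: "e v = Some x" "e u = Some y" "(x, p, y) \<in> G"
      using te(3)[OF t] by auto
    \<comment> \<open>The image triple lies in some segment \<open>Gs ! i'\<close>. Its node
      \<open>a\<close> also lies in \<open>?H\<close>, so \<open>i' \<noteq> i\<close> would make
      \<open>a\<close> a border node.\<close>
    obtain i' where i': "i' < length Gs" "(x, p, y) \<in> Gs ! i'"
      using decomposition_cover[OF dec xy(3)] .
    have "e w = Some a" using w(2) by (auto simp: restrict_map_def split: if_splits)
    then have "a \<in> nodes (Gs ! i')" using w(1) xy nodesI[OF i'(2)] by auto
    moreover have "a \<in> nodes ?H"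
      using pe w(2) unfolding partial_embedding_def by (auto simp: ran_def)
    ultimately have "i' = i" using borderI[of a Gs i i' L] i'(1) w(3) by blast
    then have "sends e (v, p, u) ?H" using xy i' by auto
    with t show ?thesis by (rule sends_trace)
  qed
  show ?thesis
    unfolding useful_def using pe nt' dom edge by blast
qed

lemma set_concat_families:
  "set (concat (map (\<lambda>j. map (E j) [0..<k j]) [0..<n])) = {E j l | j l. j < n \<and> l < k j}"
  by force

text \<open>Turns a chosen set of data segments into the strictly increasing indices required by the
  theorem.\<close>

lemma strict_mono_on_nth_sorted_list_of_set:
  fixes S :: "'a :: linorder set"
  shows "strict_mono_on {..<card S} ((!) (sorted_list_of_set S))"
  by (auto intro!: strict_mono_onI sorted_wrt_nth_less[of "(<)"])

text \<open>The range and the fixing of non-variables come from the partial embeddings, the image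
  triples from \<open>cover\<close>; totality follows because every node lies on a query
  triple.\<close>

lemma join_useful_total_embedding:
  assumes decQ: "decomposition P Q Qs" and decG: "decomposition P' G Gs"
    and useful: "\<And>j l. j < length Qs \<Longrightarrow> l < k j \<Longrightarrow>
      idx j l < length Gs \<and> useful L Var Gs (idx j l) (Qs ! j) (E j l)"
    and cover: "\<And>j t. j < length Qs \<Longrightarrow> t \<in> Qs ! j \<Longrightarrow>
      \<exists>l < k j. sends (E j l) t (Gs ! idx j l)"
    and compat: "\<And>j1 j2 l1 l2. j1 \<le> j2 \<Longrightarrow> j2 < length Qs \<Longrightarrow> l1 < k j1 \<Longrightarrow> l2 < k j2 \<Longrightarrow>
      compatible (E j1 l1) (E j2 l2)"
    and es: "set es = {E j l | j l. j < length Qs \<and> l < k j}"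
  shows "total_embedding Var Q G (join_list es)"
proof -
  let ?e = "join_list es"
  have le: "E j l \<subseteq>\<^sub>m ?e" if "j < length Qs" "l < k j" for j l
  proof (rule map_le_join_list)
    show "E j l \<in> set es" using that es by auto
    fix g assume "g \<in> set es"
    then obtain j' l' where "g = E j' l'" "j' < length Qs" "l' < k j'" using es by auto
    \<comment> \<open>\<open>compat\<close> only speaks of ordered pairs of query segments; symmetry
      covers the other order.\<close>
    then show "compatible (E j l) g"
      using that compat[of j j' l l'] compatible_sym[OF compat[of j' j l' l]]
      by (cases "j \<le> j'") auto
  qed
  have sends: "sends ?e t G" if t: "t \<in> Q" for t
  proof -
    obtain j where j: "j < length Qs" "t \<in> Qs ! j" using decomposition_cover[OF decQ t] .
    then obtain l where l: "l < k j" "sends (E j l) t (Gs ! idx j l)" using cover by blast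
    then show ?thesis
      using sends_mono le[OF j(1) l(1)] decomposition_subset[OF decG] useful[OF j(1) l(1)]
      by blast
  qed
  have val: "v \<in> nodes Q \<and> a \<in> nodes G \<and> (v \<notin> Var \<longrightarrow> a = v)" if a: "?e v = Some a" for v a
  proof -
    obtain j l where jl: "j < length Qs" "l < k j" "E j l v = Some a"
      using join_list_SomeD[OF a] es by auto
    then have i: "idx j l < length Gs"
      and pe: "partial_embedding Var (Qs ! j) (Gs ! idx j l) (E j l)"
      using useful by (auto simp: useful_def)
    from pe jl(3) have "v \<in> nodes (Qs ! j)" "a \<in> nodes (Gs ! idx j l)" "v \<notin> Var \<Longrightarrow> a = v"
      unfolding partial_embedding_def by (auto simp: ran_def)
    then show ?thesis
      using nodes_mono[OF decomposition_subset[OF decQ jl(1)]]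
        nodes_mono[OF decomposition_subset[OF decG i]] by blast
  qed
  have "v \<in> dom ?e" if "v \<in> nodes Q" for v
    using that sends by (fastforce elim: nodesE)
  then show ?thesis
    unfolding total_embedding_def using val sends by (fastforce simp: ran_def dom_def)
qed

theorem theorem3:
  fixes Uso Up L Var :: "'a set"
    and Q G :: "'a graph"
    and Qs Gs :: "'a graph list"
    and e :: "'a \<rightharpoonup> 'a"
  assumes "vocabulary Uso Up L Var"
    and "query_graph Uso Up L Var Q"
    and "decomposition (query_graph Uso Up L Var) Q Qs"
    and "data_graph Uso Up L G"
    and "decomposition (data_graph Uso Up L) G Gs"
  shows "total_embedding Var Q G e \<longleftrightarrow>
    (\<exists>(k :: nat \<Rightarrow> nat) (idx :: nat \<Rightarrow> nat \<Rightarrow> nat) (E :: nat \<Rightarrow> nat \<Rightarrow> ('a \<rightharpoonup> 'a)).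
       (\<forall>j < length Qs.
          strict_mono_on {..<k j} (idx j) \<and>
          (\<forall>l < k j. idx j l < length Gs \<and> useful L Var Gs (idx j l) (Qs ! j) (E j l))) \<and>
       (\<forall>j < length Qs. \<forall>t \<in> Qs ! j. \<exists>l < k j. sends (E j l) t (Gs ! idx j l)) \<and>
       (\<forall>j1 j2 l1 l2. j1 \<le> j2 \<and> j2 < length Qs \<and> l1 < k j1 \<and> l2 < k j2 \<longrightarrow>
          compatible (E j1 l1) (E j2 l2)) \<and>
       join_list (concat (map (\<lambda>j. map (E j) [0..<k j]) [0..<length Qs])) = e)"
  (is "_ \<longleftrightarrow> ?rhs")
proof
  assume tot: "total_embedding Var Q G e"
  \<comment> \<open>Outside \<open>S j\<close> no restriction of \<open>e\<close> is non-trivial, so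
    exactly the segments receiving some triple of \<open>Qs ! j\<close> are enumerated.\<close>
  define S where "S j = {i. i < length Gs \<and> nontrivial (Qs ! j) (Gs ! i) e}" for j
  define idx where "idx j l = sorted_list_of_set (S j) ! l" for j l
  define E where "E j l = e |` trace_dom e (Qs ! j) (Gs ! idx j l)" for j l
  have fin: "finite (S j)" for j by (simp add: S_def)
  have idx_S: "idx j l \<in> S j" if "l < card (S j)" for j l
    using that nth_mem[of l "sorted_list_of_set (S j)"] fin[of j] by (simp add: idx_def)
  have S_idx: "\<exists>l < card (S j). idx j l = i" if "i \<in> S j" for i j
    using that fin[of j] in_set_conv_nth[of i "sorted_list_of_set (S j)"]
    by (auto simp: idx_def)
  note sub = decomposition_subset[OF assms(3)]
  have mono: "strict_mono_on {..<card (S j)} (idx j)" for j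
    unfolding idx_def by (rule strict_mono_on_nth_sorted_list_of_set)
  have useful: "idx j l < length Gs \<and> useful L Var Gs (idx j l) (Qs ! j) (E j l)"
    if "j < length Qs" "l < card (S j)" for j l
    using idx_S[OF that(2)] trace_useful[OF assms(1,5) _ tot sub[OF that(1)], of "idx j l"]
    by (simp add: S_def E_def)
  have cover: "\<exists>l < card (S j). sends (E j l) t (Gs ! idx j l)"
    if j: "j < length Qs" and t: "t \<in> Qs ! j" for j t
  proof -
    obtain v p u where vpu: "t = (v, p, u)" by (cases t)
    obtain a b where ab: "e v = Some a" "e u = Some b" "(a, p, b) \<in> G"
      using total_embedding_mono(3)[OF tot sub[OF j] t] vpu by auto
    obtain i where i: "i < length Gs" "(a, p, b) \<in> Gs ! i"
      using decomposition_cover[OF assms(5) ab(3)] .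
    have s: "sends e t (Gs ! i)" using vpu ab i by simp
    \<comment> \<open>The triple \<open>t\<close> itself witnesses that segment \<open>i\<close> was
      selected.\<close>
    then have "i \<in> S j" using i t by (auto simp: S_def nontrivial_def)
    then obtain l where "l < card (S j)" "idx j l = i" using S_idx by blast
    then show ?thesis using sends_trace[OF t s] unfolding E_def by auto
  qed
  have "join_list (concat (map (\<lambda>j. map (E j) [0..<card (S j)]) [0..<length Qs])) = e"
  proof (rule join_list_eqI, unfold set_concat_families)
    fix f assume "f \<in> {E j l | j l. j < length Qs \<and> l < card (S j)}"
    then show "f \<subseteq>\<^sub>m e" by (auto simp: E_def map_le_def restrict_map_def split: if_splits)
  next
    show "dom e \<subseteq> (\<Union>f \<in> {E j l | j l. j < length Qs \<and> l < card (S j)}. dom f)"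
    proof
      fix x assume "x \<in> dom e"
      then have "x \<in> nodes Q" using tot by (simp add: total_embedding_def)
      then obtain j where j: "j < length Qs" "x \<in> nodes (Qs ! j)"
        using decomposition_node_cover[OF assms(3)] by blast
      then obtain v p u where t: "(v, p, u) \<in> Qs ! j" "x = v \<or> x = u" by (auto elim: nodesE)
      \<comment> \<open>The covering condition already forces the join to be defined at
        \<open>x\<close>, since \<open>x\<close> is an end of a covered triple.\<close>
      obtain l where "l < card (S j)" "sends (E j l) (v, p, u) (Gs ! idx j l)"
        using cover[OF j(1) t(1)] by blast
      with t(2) have "l < card (S j)" "x \<in> dom (E j l)" by auto
      with j(1) show "x \<in> (\<Union>f \<in> {E j l | j l. j < length Qs \<and> l < card (S j)}. dom f)"
        by blast
    qed
  qed
  moreover have "compatible (E j1 l1) (E j2 l2)" for j1 j2 l1 l2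
    unfolding E_def by (rule compatible_restrict)
  ultimately show ?rhs
    using mono useful cover by (intro exI[of _ "\<lambda>j. card (S j)"] exI[of _ idx] exI[of _ E] conjI allI ballI impI) auto
next
  assume ?rhs
  then obtain k :: "nat \<Rightarrow> nat" and idx :: "nat \<Rightarrow> nat \<Rightarrow> nat"
    and E :: "nat \<Rightarrow> nat \<Rightarrow> ('a \<rightharpoonup> 'a)" where
    useful: "\<forall>j < length Qs. strict_mono_on {..<k j} (idx j) \<and>
      (\<forall>l < k j. idx j l < length Gs \<and> useful L Var Gs (idx j l) (Qs ! j) (E j l))" and
    cover: "\<forall>j < length Qs. \<forall>t \<in> Qs ! j. \<exists>l < k j. sends (E j l) t (Gs ! idx j l)" and
    compat: "\<forall>j1 j2 l1 l2. j1 \<le> j2 \<and> j2 < length Qs \<and> l1 < k j1 \<and> l2 < k j2 \<longrightarrow>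
      compatible (E j1 l1) (E j2 l2)" and
    e: "join_list (concat (map (\<lambda>j. map (E j) [0..<k j]) [0..<length Qs])) = e"
    by blast
  show "total_embedding Var Q G e"
    unfolding e[symmetric]
  proof (rule join_useful_total_embedding[OF assms(3,5) _ _ _ set_concat_families])
    show "idx j l < length Gs \<and> useful L Var Gs (idx j l) (Qs ! j) (E j l)"
      if "j < length Qs" "l < k j" for j l
      using useful that by blast
    show "\<exists>l < k j. sends (E j l) t (Gs ! idx j l)" if "j < length Qs" "t \<in> Qs ! j" for j t
      using cover that by blast
    show "compatible (E j1 l1) (E j2 l2)"
      if "j1 \<le> j2" "j2 < length Qs" "l1 < k j1" "l2 < k j2" for j1 j2 l1 l2
      using compat that by blast
  qed
qed

end
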